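(* Let $F$ be a nullnorm with absorbing element $k$, let $(M,\circ)$ be a monoid with identity element $e$, and let $\sigma:M\to[0,1]$ be an $F$-fuzzy submonoid of $M$. Then $\sigma(x)\ge k$ for every $x\in M$.
   Context: A nullnorm with absorbing element $k\in[0,1]$ is a map $F:[0,1]^2\to[0,1]$ that is commutative, associative, non-decreasing in each argument, with $F(k,x)=k$ for all $x\in[0,1]$, $F(0,x)=x$ for all $x\le k$, and $F(1,x)=x$ for all $x\ge k$. A map $\sigma:M\to[0,1]$ is an $F$-fuzzy submonoid of $M$ if $F(\sigma(x),\sigma(y))\le\sigma(x\circ y)$ for all $x,y\in M$ and $\sigma(e)=1$. *)

theory Defs
  imports Complex_Main "HOL-Algebra.Group"
begin

text \<open>
  Operations on the unit interval are rendered as curried functions on the reals; every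
  condition is relativised to the interval \<open>{0..1}\<close>, and values outside it are irrelevant.
\<close>

definition nullnorm :: "real \<Rightarrow> (real \<Rightarrow> real \<Rightarrow> real) \<Rightarrow> bool" where
  "nullnorm k F \<longleftrightarrow>
     k \<in> {0..1} \<and>
     (\<forall>x\<in>{0..1}. \<forall>y\<in>{0..1}. F x y \<in> {0..1}) \<and>
     (\<forall>x\<in>{0..1}. \<forall>y\<in>{0..1}. F x y = F y x) \<and>
     (\<forall>x\<in>{0..1}. \<forall>y\<in>{0..1}. \<forall>z\<in>{0..1}. F (F x y) z = F x (F y z)) \<and>
     (\<forall>y\<in>{0..1}. mono_on {0..1} (\<lambda>x. F x y)) \<and>
     (\<forall>x\<in>{0..1}. mono_on {0..1} (\<lambda>y. F x y)) \<and>
     (\<forall>x\<in>{0..1}. F k x = k) \<and>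
     (\<forall>x\<in>{0..k}. F 0 x = x) \<and>
     (\<forall>x\<in>{k..1}. F 1 x = x)"

definition fuzzy_submonoid ::
    "(real \<Rightarrow> real \<Rightarrow> real) \<Rightarrow> ('a, 'b) monoid_scheme \<Rightarrow> ('a \<Rightarrow> real) \<Rightarrow> bool" where
  "fuzzy_submonoid F M \<sigma> \<longleftrightarrow>
     \<sigma> \<in> carrier M \<rightarrow> {0..1} \<and>
     (\<forall>x\<in>carrier M. \<forall>y\<in>carrier M. F (\<sigma> x) (\<sigma> y) \<le> \<sigma> (x \<otimes>\<^bsub>M\<^esub> y)) \<and>
     \<sigma> \<one>\<^bsub>M\<^esub> = 1"

end

theory Submission
  imports Defs
begin

text \<open>Pair \<open>x\<close> with the identity: since \<open>\<one>\<close> has membership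
  degree 1 and multiplying by it changes nothing, the submonoid inequality bounds
  \<open>\<sigma> x\<close> below by \<open>F 1 (\<sigma> x)\<close>. As 1 is at least k,
  monotonicity puts this above \<open>F k (\<sigma> x)\<close>, which absorption collapses to
  k.\<close>

theorem proposition3p11:
  fixes F :: "real \<Rightarrow> real \<Rightarrow> real" and k :: real
    and M :: "('a, 'b) monoid_scheme" and \<sigma> :: "'a \<Rightarrow> real"
  assumes "nullnorm k F"
    and "monoid M"
    and "fuzzy_submonoid F M \<sigma>"
  shows "\<forall>x\<in>carrier M. \<sigma> x \<ge> k"
proof
  fix x assume x: "x \<in> carrier M"
  interpret monoid M by fact
  have F: "k \<in> {0..1}" "mono_on {0..1} (\<lambda>s. F s y)" "F k y = k" if "y \<in> {0..1}" for y
    using assms(1) that unfolding nullnorm_def by blast+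
  have \<sigma>: "\<sigma> x \<in> {0..1}" "F (\<sigma> \<one>\<^bsub>M\<^esub>) (\<sigma> x) \<le> \<sigma> (\<one>\<^bsub>M\<^esub> \<otimes>\<^bsub>M\<^esub> x)" "\<sigma> \<one>\<^bsub>M\<^esub> = 1"
    using assms(3) x one_closed unfolding fuzzy_submonoid_def by blast+
  have "k = F k (\<sigma> x)" using F(3)[OF \<sigma>(1)] by simp
  also have "\<dots> \<le> F 1 (\<sigma> x)"
    \<comment> \<open>Monotonicity holds only on the unit interval, so membership of k supplies both
      the domain condition and \<open>k \<le> 1\<close>.\<close>
    using F(1)[OF \<sigma>(1)] by (intro mono_onD[OF F(2)[OF \<sigma>(1)]]) auto
  \<comment> \<open>The left unit law turns the product \<open>\<one> \<otimes> x\<close> back into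
    \<open>x\<close>.\<close>
  also have "\<dots> \<le> \<sigma> x" using \<sigma>(2,3) x by simp
  finally show "\<sigma> x \<ge> k" .
qed

end
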